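(* Let $\{z^k=(\boldsymbol\omega^{(k)},\boldsymbol m^{(k)})\}_{k\in\mathbb{N}}$ be the sequence generated by the IRCSI algorithm (defined in the context) with $\gamma,\beta>0$. Then the following statements hold. (i) The sequence $\{z^k\}_{k\in\mathbb{N}}$ is convergent. (ii) Let $n_j=M$ be the dimension of the variable $\boldsymbol\omega_j$, let $L\ge\max_{1\le j\le J}\sqrt{n_j}$ be a constant such that $\|\xi\|_1\le L\|\xi\|$ for any $\xi\in\mathbb{C}^{n_j}$, $j=1,\dots,J$, and let $\varepsilon=\max\{\gamma L,\beta\}$. Then the limit point $z^*$ of $\{z^k\}_{k\in\mathbb{N}}$ is an $\varepsilon$-stationary point of the objective function $F^{csi}$, that is, $$\|\nabla F^{csi}(z^* )\|_\infty\le\varepsilon.$$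
   Context: Notation. $\|\cdot\|$, $\|\cdot\|_1$, $\|\cdot\|_\infty$ denote the $\ell_2$-norm, the $\ell_1$-norm (sum of moduli) and the infinity norm (maximum modulus) of complex vectors; $(\boldsymbol\xi)_\ell$ is the $\ell$-th element of $\boldsymbol\xi$; $\langle a,b\rangle=b^*a=\sum_\ell a_\ell\overline{b_\ell}$; $\odot$ is the entrywise product. For a real-valued function $\psi$ on $\mathbb{C}^q$, writing $w=w_r+iw_i$ with $w_r,w_i\in\mathbb{R}^q$ and $\psi(w)=\widetilde\psi(w_r,w_i)$, the complex gradient is $\nabla_w\psi:=\nabla_{w_r}\widetilde\psi+i\nabla_{w_i}\widetilde\psi$; $\nabla F^{csi}$ is the complex gradient with respect to all variables $(\boldsymbol\omega_1,\dots,\boldsymbol\omega_J,\boldsymbol m)$. For $\tau\ge0$, $S_\tau:\mathbb{C}\to\mathbb{C}$ is $S_\tau(a)=(|a|-\tau)\frac{a}{|a|}$ if $|a|>\tau$ and $S_\tau(a)=0$ if $|a|\le\tau$. Discrete scattering data. Let $n\in\{2,3\}$, wave number $\kappa>0$, mesh size $h>0$, $N\in\mathbb{N}$ positive, $M=N^n$, and let $p^1,\dots,p^M$ be an enumeration of $\{p\in\mathbb{Z}^n:-N/2<p_k\le N/2,\ k=1,\dots,n\}$. Let $\Phi(\kappa r)=\frac i4H_0^{(1)}(\kappa r)$ if $n=2$ (with $H_0^{(1)}$ the Hankel function of the first kind of order zero) and $\Phi(\kappa r)=\frac1{4\pi}\frac{e^{i\kappa r}}{\kappa r}$ if $n=3$;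 put $\Phi_{p,h}=\Phi(\kappa|p|h)$ for $p\ne0$ and $\Phi_{0,h}=0$. Let $T\in\mathbb{C}^{M\times M}$ have entries $T_{ab}=\kappa^nh^n\Phi_{p^a-p^b,h}$. Let $\hat x^1,\dots,\hat x^Q$ be distinct unit vectors of $\mathbb{R}^n$ (observation directions) and let $T^\infty\in\mathbb{C}^{Q\times M}$ have entries $T^\infty_{ab}=\theta_{n,\kappa}h^ne^{-i\kappa\hat x^a\cdot p^bh}$, with $\theta_{2,\kappa}=\kappa^{3/2}e^{i\pi/4}/\sqrt{8\pi}$, $\theta_{3,\kappa}=\kappa^2/(4\pi)$. For $j=1,\dots,J$ let $d_j$ be distinct unit vectors (incident directions), $\boldsymbol u^i_j=(e^{i\kappa p^1h\cdot d_j},\dots,e^{i\kappa p^Mh\cdot d_j})^\top\in\mathbb{C}^M$, and let $\boldsymbol u_j^{\infty,\delta}\in\mathbb{C}^Q$ be the given (noisy) measurement data. Objective. For $\boldsymbol\omega_j,\boldsymbol m\in\mathbb{C}^M$ and positive constants $\eta_{s,j},\eta_{d,j}$, $$F_j^{csi}(\boldsymbol\omega_j,\boldsymbol m)=\eta_{s,j}\|\boldsymbol m\odot\boldsymbol u^i_j+\boldsymbol m\odot T\boldsymbol\omega_j-\boldsymbol\omega_j\|^2+\eta_{d,j}\|\boldsymbol u_j^{\infty,\delta}-T^\infty\boldsymbol\omega_j\|^2,$$ and $F^{csi}(\boldsymbol\omega,\boldsymbol m)=\sum_{j=1}^JF_j^{csi}(\boldsymbol\omega_j,\boldsymbol m)$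 with $\boldsymbol\omega=(\boldsymbol\omega_1,\dots,\boldsymbol\omega_J)$. IRCSI algorithm (run without termination). Start from given initial vectors $\boldsymbol\omega_1^{(0)},\dots,\boldsymbol\omega_J^{(0)},\boldsymbol m^{(0)}\in\mathbb{C}^M$. For $r=0,1,2,\dots$: 1. For all $j$ compute $g_j^{(r)}=\nabla_{\boldsymbol\omega_j}F^{csi}(\boldsymbol\omega^{(r)},\boldsymbol m^{(r)})$ and the direction $\boldsymbol v_j^{(r)}$: $\boldsymbol v_j^{(0)}=g_j^{(0)}$ and, for $r\ge1$, $\boldsymbol v_j^{(r)}=g_j^{(r)}+\frac{\mathrm{Re}\langle g_j^{(r)},g_j^{(r)}-g_j^{(r-1)}\rangle}{\|g_j^{(r-1)}\|^2}\boldsymbol v_j^{(r-1)}$ if $g_j^{(r-1)}\ne0$, $\boldsymbol v_j^{(r)}=g_j^{(r)}$ if $g_j^{(r-1)}=0$. 2. Set $\boldsymbol\omega_j^{(r+1)}=\boldsymbol\omega_j^{(r)}+s_j^{(r)}\boldsymbol v_j^{(r)}$, where, with $B=2\eta_{s,j}\|\boldsymbol v_j^{(r)}-\boldsymbol m^{(r)}\odot T\boldsymbol v_j^{(r)}\|^2+2\eta_{d,j}\|T^\infty\boldsymbol v_j^{(r)}\|^2$, $s_j^{(r)}=0$ if $B=0$ and otherwise $s_j^{(r)}=S_\tau(z)$ with $\tau=\gamma\|\boldsymbol v_j^{(r)}\|_1/B$, $z=-\langle g_j^{(r)},\boldsymbol v_j^{(r)}\rangle/B$. (This $s_j^{(r)}$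 is the chosen element of $\arg\min_{s\in\mathbb{C}}F_j^{csi}(\boldsymbol\omega_j^{(r)}+s\boldsymbol v_j^{(r)},\boldsymbol m^{(r)})+\gamma\|s\boldsymbol v_j^{(r)}\|_1$.) 3. With $\boldsymbol u_j^{(r+1)}=\boldsymbol u^i_j+T\boldsymbol\omega_j^{(r+1)}$ and, for each $\ell$, $A_\ell=\sum_{j=1}^J\eta_{s,j}|(\boldsymbol u_j^{(r+1)})_\ell|^2$, set $(\boldsymbol m^{(r+1)})_\ell=(\boldsymbol m^{(r)})_\ell$ if $(\boldsymbol u_j^{(r+1)})_\ell=0$ for all $j$, and otherwise $(\boldsymbol m^{(r+1)})_\ell=(\boldsymbol m^{(r)})_\ell+S_\tau(z-(\boldsymbol m^{(r)})_\ell)$ with $\tau=\beta/(2A_\ell)$ and $z=A_\ell^{-1}\sum_{j=1}^J\eta_{s,j}\overline{(\boldsymbol u_j^{(r+1)})_\ell}(\boldsymbol\omega_j^{(r+1)})_\ell$. (This $\boldsymbol m^{(r+1)}$ is the chosen element of $\arg\min_{\boldsymbol m\in\mathbb{C}^M}F^{csi}(\boldsymbol\omega^{(r+1)},\boldsymbol m)+\beta\|\boldsymbol m-\boldsymbol m^{(r)}\|_1$.) *)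

theory Defs
  imports "HOL-Analysis.Analysis"
begin

text \<open>
  Vectors in \<open>\<complex>\<^sup>q\<close> are elements of \<open>complex ^ 'q\<close>: \<open>norm\<close> is the Euclidean norm and \<open>*\<close> is
  the entrywise product.
\<close>

definition l1_norm :: "complex ^ 'q \<Rightarrow> real" where
  "l1_norm x = (\<Sum>l\<in>UNIV. cmod (x $ l))"

text \<open>The library's \<open>infnorm\<close> is different: on complex vectors it takes the maximum over all
  real and imaginary parts rather than over the moduli.\<close>

definition max_norm :: "complex ^ 'q \<Rightarrow> real" where
  "max_norm x = Max (range (\<lambda>l. cmod (x $ l)))"

text \<open>\<open>\<langle>a, b\<rangle> = b\<^sup>* a\<close>, linear in the first argument.\<close>

definition cdot :: "complex ^ 'q \<Rightarrow> complex ^ 'q \<Rightarrow> complex" where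
  "cdot a b = (\<Sum>l\<in>UNIV. a $ l * cnj (b $ l))"

definition soft :: "real \<Rightarrow> complex \<Rightarrow> complex" where
  "soft \<tau> a = (if cmod a > \<tau> then of_real (cmod a - \<tau>) * (a / of_real (cmod a)) else 0)"

definition real_gradient :: "(real ^ 'q \<Rightarrow> real) \<Rightarrow> real ^ 'q \<Rightarrow> real ^ 'q" where
  "real_gradient f x = (THE D. GDERIV f x :> D)"

definition complex_gradient :: "(complex ^ 'q \<Rightarrow> real) \<Rightarrow> complex ^ 'q \<Rightarrow> complex ^ 'q" where
  "complex_gradient \<psi> w =
    (let \<psi>' = (\<lambda>wr wi. \<psi> (\<chi> l. Complex (wr $ l) (wi $ l)));
         wr = (\<chi> l. Re (w $ l));
         wi = (\<chi> l. Im (w $ l));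
         gr = real_gradient (\<lambda>x. \<psi>' x wi) wr;
         gi = real_gradient (\<lambda>y. \<psi>' wr y) wi
     in \<chi> l. Complex (gr $ l) (gi $ l))"


text \<open>
  Bessel functions of the first and second kind of order zero at \<open>x > 0\<close>, by their power series
  \<^item> \<open>J\<^sub>0(x) = \<Sum>k. (-1)\<^sup>k (x/2)\<^sup>2\<^sup>k / (k!)\<^sup>2\<close>,
  \<^item> \<open>Y\<^sub>0(x) = 2/\<pi> (ln (x/2) + \<gamma>) J\<^sub>0(x) + 2/\<pi> \<Sum>k. (-1)\<^sup>k\<^sup>+\<^sup>1 H\<^sub>k (x/2)\<^sup>2\<^sup>k / (k!)\<^sup>2\<close>
  with \<open>\<gamma>\<close> Euler's constant and \<open>H\<^sub>k\<close> the harmonic numbers (\<open>H\<^sub>0 = 0\<close>).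
\<close>

definition bessel_J0 :: "real \<Rightarrow> real" where
  "bessel_J0 x = (\<Sum>k. (-1) ^ k * (x / 2) ^ (2 * k) / (fact k)\<^sup>2)"

definition bessel_Y0 :: "real \<Rightarrow> real" where
  "bessel_Y0 x = 2 / pi * (ln (x / 2) + euler_mascheroni) * bessel_J0 x
     + 2 / pi * (\<Sum>k. (-1) ^ (k + 1) * harm k * (x / 2) ^ (2 * k) / (fact k)\<^sup>2)"

definition hankel1_0 :: "real \<Rightarrow> complex" where
  "hankel1_0 x = Complex (bessel_J0 x) (bessel_Y0 x)"


text \<open>
  In the following two definitions \<open>n\<close> is the space dimension, and the last branch is meant for
  \<open>n = 3\<close>. The argument \<open>t\<close> of \<open>fund_sol\<close> stands for \<open>\<kappa> r\<close>.
\<close>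

definition fund_sol :: "nat \<Rightarrow> real \<Rightarrow> complex" where
  "fund_sol n t = (if n = 2 then \<i> / 4 * hankel1_0 t
                   else 1 / (4 * of_real pi) * (exp (\<i> * of_real t) / of_real t))"

definition far_const :: "nat \<Rightarrow> real \<Rightarrow> complex" where
  "far_const n \<kappa> = (if n = 2 then of_real (\<kappa> powr (3/2)) * exp (\<i> * of_real pi / 4)
                                / of_real (sqrt (8 * pi))
                   else of_real (\<kappa>\<^sup>2 / (4 * pi)))"

definition real_vec :: "int ^ 'n \<Rightarrow> real ^ 'n" where
  "real_vec p = (\<chi> k. real_of_int (p $ k))"

definition grid :: "nat \<Rightarrow> (int ^ 'n) set" where
  "grid N = {p. \<forall>k. - (real N / 2) < real_of_int (p $ k) \<and> real_of_int (p $ k) \<le> real N / 2}"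

definition Phi_grid :: "real \<Rightarrow> real \<Rightarrow> int ^ 'n \<Rightarrow> complex" where
  "Phi_grid \<kappa> h p = (if p = 0 then 0 else fund_sol CARD('n) (\<kappa> * norm (real_vec p) * h))"


text \<open>
  The variables \<open>(\<omega>\<^sub>1, \<dots>, \<omega>\<^sub>J, m)\<close> as one complex vector: the entry \<open>Inl (j, l)\<close> is
  \<open>(\<omega>\<^sub>j)\<^sub>l\<close> and the entry \<open>Inr l\<close> is \<open>m\<^sub>l\<close>.
\<close>

definition stack :: "complex ^ 'm ^ 'j \<Rightarrow> complex ^ 'm \<Rightarrow> complex ^ (('j::finite) \<times> ('m::finite) + 'm)" where
  "stack \<omega> m = (\<chi> i. case i of Inl (j, l) \<Rightarrow> \<omega> $ j $ l | Inr l \<Rightarrow> m $ l)"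

definition omega_part :: "complex ^ (('j::finite) \<times> ('m::finite) + 'm) \<Rightarrow> complex ^ 'm ^ 'j" where
  "omega_part z = (\<chi> j l. z $ Inl (j, l))"

definition m_part :: "complex ^ (('j::finite) \<times> ('m::finite) + 'm) \<Rightarrow> complex ^ 'm" where
  "m_part z = (\<chi> l. z $ Inr l)"


text \<open>
  The index types \<open>'m\<close>, \<open>'q\<close>, \<open>'j\<close> enumerate the grid points, the observation directions \<open>xhat\<close>
  and the incident directions \<open>d\<close>; \<open>ud j\<close> is the measured far field for the incident
  direction \<open>d j\<close>. The locale only fixes the parameters and carries no assumptions.
\<close>

locale ircsi =
  fixes \<kappa> h :: real
    and p :: "'m::finite \<Rightarrow> int ^ 'n"
    and xhat :: "'q::finite \<Rightarrow> real ^ 'n"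
    and d :: "'j::finite \<Rightarrow> real ^ 'n"
    and ud :: "'j \<Rightarrow> complex ^ 'q"
    and \<eta>\<^sub>s \<eta>\<^sub>d :: "'j \<Rightarrow> real"
    and \<gamma> \<beta> :: real
begin

definition T :: "complex ^ 'm ^ 'm" where
  "T = (\<chi> a b. of_real (\<kappa> ^ CARD('n) * h ^ CARD('n)) * Phi_grid \<kappa> h (p a - p b))"

definition Tinf :: "complex ^ 'm ^ 'q" where
  "Tinf = (\<chi> a b. far_const CARD('n) \<kappa> * of_real (h ^ CARD('n))
                    * exp (- \<i> * of_real (\<kappa> * (xhat a \<bullet> real_vec (p b)) * h)))"

definition ui :: "'j \<Rightarrow> complex ^ 'm" where
  "ui j = (\<chi> l. exp (\<i> * of_real (\<kappa> * h * (real_vec (p l) \<bullet> d j))))"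

definition F_part :: "'j \<Rightarrow> complex ^ 'm \<Rightarrow> complex ^ 'm \<Rightarrow> real" where
  "F_part j w m = \<eta>\<^sub>s j * (norm (m * ui j + m * (T *v w) - w))\<^sup>2
                  + \<eta>\<^sub>d j * (norm (ud j - Tinf *v w))\<^sup>2"

definition F :: "complex ^ 'm ^ 'j \<Rightarrow> complex ^ 'm \<Rightarrow> real" where
  "F \<omega> m = (\<Sum>j\<in>UNIV. F_part j (\<omega> $ j) m)"

definition F_stacked :: "complex ^ ('j \<times> 'm + 'm) \<Rightarrow> real" where
  "F_stacked z = F (omega_part z) (m_part z)"

definition grad_omega :: "complex ^ 'm ^ 'j \<Rightarrow> complex ^ 'm \<Rightarrow> 'j \<Rightarrow> complex ^ 'm" where
  "grad_omega \<omega> m j = complex_gradient (\<lambda>w. F (\<chi> i. if i = j then w else \<omega> $ i) m) (\<omega> $ j)"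

text \<open>The arguments are the current gradient, the previous gradient and the previous direction.\<close>

definition direction :: "complex ^ 'm \<Rightarrow> complex ^ 'm \<Rightarrow> complex ^ 'm \<Rightarrow> complex ^ 'm" where
  "direction g g' v' = (if g' = 0 then g
                        else g + (Re (cdot g (g - g')) / (norm g')\<^sup>2) *\<^sub>R v')"

definition step_size :: "'j \<Rightarrow> complex ^ 'm ^ 'j \<Rightarrow> complex ^ 'm \<Rightarrow> complex ^ 'm \<Rightarrow> complex" where
  "step_size j \<omega> m v =
    (let B = 2 * \<eta>\<^sub>s j * (norm (v - m * (T *v v)))\<^sup>2 + 2 * \<eta>\<^sub>d j * (norm (Tinf *v v))\<^sup>2
     in if B = 0 then 0
        else soft (\<gamma> * l1_norm v / B) (- cdot (grad_omega \<omega> m j) v / of_real B))"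

definition omega_update ::
    "complex ^ 'm ^ 'j \<Rightarrow> complex ^ 'm \<Rightarrow> complex ^ 'm ^ 'j \<Rightarrow> complex ^ 'm ^ 'j" where
  "omega_update \<omega> m v = (\<chi> j. \<omega> $ j + step_size j \<omega> m (v $ j) *s (v $ j))"

text \<open>Here \<open>\<omega>\<close> is the already updated iterate and \<open>m\<close> the previous one.\<close>

definition m_update :: "complex ^ 'm ^ 'j \<Rightarrow> complex ^ 'm \<Rightarrow> complex ^ 'm" where
  "m_update \<omega> m = (\<chi> l.
    (let u = (\<lambda>j. (ui j + T *v (\<omega> $ j)) $ l);
         A = (\<Sum>j\<in>UNIV. \<eta>\<^sub>s j * (cmod (u j))\<^sup>2);
         z = (\<Sum>j\<in>UNIV. of_real (\<eta>\<^sub>s j) * cnj (u j) * \<omega> $ j $ l) / of_real A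
     in if \<forall>j. u j = 0 then m $ l else m $ l + soft (\<beta> / (2 * A)) (z - m $ l)))"

text \<open>\<open>state \<omega>0 m0 r\<close> is the triple \<open>(\<omega>\<^sup>(\<^sup>r\<^sup>), m\<^sup>(\<^sup>r\<^sup>), v\<^sup>(\<^sup>r\<^sup>))\<close> for the initial vectors \<open>\<omega>0\<close>, \<open>m0\<close>.\<close>

primrec state :: "complex ^ 'm ^ 'j \<Rightarrow> complex ^ 'm \<Rightarrow> nat
    \<Rightarrow> (complex ^ 'm ^ 'j) \<times> (complex ^ 'm) \<times> (complex ^ 'm ^ 'j)" where
  "state \<omega>0 m0 0 = (\<omega>0, m0, \<chi> j. grad_omega \<omega>0 m0 j)"
| "state \<omega>0 m0 (Suc r) =
    (case state \<omega>0 m0 r of (\<omega>, m, v) \<Rightarrow>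
      (let \<omega>' = omega_update \<omega> m v;
           m' = m_update \<omega>' m;
           v' = (\<chi> j. direction (grad_omega \<omega>' m' j) (grad_omega \<omega> m j) (v $ j))
       in (\<omega>', m', v')))"

definition iterate :: "complex ^ 'm ^ 'j \<Rightarrow> complex ^ 'm \<Rightarrow> nat \<Rightarrow> complex ^ ('j \<times> 'm + 'm)" where
  "iterate \<omega>0 m0 k = (case state \<omega>0 m0 k of (\<omega>, m, v) \<Rightarrow> stack \<omega> m)"

end

end

theory Submission
  imports Defs
begin

text \<open>
  Both half steps minimize a quadratic plus an \<open>\<ell>\<^sub>1\<close> penalty on the step, so each of them decreases
  \<open>F\<close> by at least a fixed multiple of the \<open>\<ell>\<^sub>1\<close> norm of the step. As \<open>F \<ge> 0\<close>, the steps are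
  summable and the iterates converge.

  The optimality condition of the contrast step bounds the entries of the \<open>m\<close>-gradient at every
  iterate by \<open>\<beta>\<close>. The one of the line search only gives
  \<open>\<bar>\<langle>g, v\<rangle>\<bar> \<le> \<gamma> \<parallel>v\<parallel>\<^sub>1\<close> along the direction \<open>v\<close>; but if the gradients \<open>g\<close> have
  a nonzero limit \<open>G\<close>, then the Polak-Ribiere coefficients tend to \<open>0\<close>, hence \<open>v\<close> tends to \<open>G\<close> and
  \<open>\<parallel>G\<parallel>\<^sup>2 \<le> \<gamma> \<parallel>G\<parallel>\<^sub>1 \<le> \<gamma> L \<parallel>G\<parallel>\<close>.
\<close>

section \<open>Complex vectors and gradients\<close>

lemma cdot_add_left: "cdot (a + b) c = cdot a c + cdot b c"
  by (simp add: cdot_def distrib_right sum.distrib)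

lemma cdot_diff_left: "cdot (a - b) c = cdot a c - cdot b c"
  by (simp add: cdot_def left_diff_distrib sum_subtractf)

lemma cdot_diff_right: "cdot a (b - c) = cdot a b - cdot a c"
  by (simp add: cdot_def right_diff_distrib sum_subtractf)

lemma cdot_vec_scale_left: "cdot (c *s a) b = c * cdot a b"
  by (simp add: cdot_def sum_distrib_left mult.assoc)

lemma cdot_scaleR_left: "cdot (c *\<^sub>R a) b = of_real c * cdot a b"
  by (simp add: cdot_def scaleR_sum_right scaleR_conv_of_real[symmetric])

lemma cdot_self: "cdot a a = of_real ((norm a)\<^sup>2)"
  unfolding cdot_def complex_norm_square[symmetric]
  by (simp add: norm_vec_def L2_set_def sum_nonneg)

lemma inner_eq_Re_cdot: "a \<bullet> b = Re (cdot a b)"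
  by (simp add: inner_vec_def cdot_def inner_complex_def)

lemma norm_add_vec_scale_squared:
  "(norm (a + s *s b))\<^sup>2 = (norm a)\<^sup>2 + 2 * Re (cnj s * cdot a b) + (cmod s)\<^sup>2 * (norm b)\<^sup>2"
proof -
  have "(norm (a + s *s b))\<^sup>2 = (norm a)\<^sup>2 + 2 * (a \<bullet> (s *s b)) + (norm (s *s b))\<^sup>2"
    by (simp add: power2_norm_eq_inner inner_add_left inner_add_right inner_commute)
  moreover have "a \<bullet> (s *s b) = Re (cnj s * cdot a b)"
    unfolding inner_eq_Re_cdot cdot_def sum_distrib_left by (simp add: algebra_simps)
  moreover have "(norm (s *s b))\<^sup>2 = (cmod s)\<^sup>2 * (norm b)\<^sup>2"
    by (simp add: norm_vec_def L2_set_def sum_nonneg norm_mult power_mult_distrib sum_distrib_left)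
  ultimately show ?thesis by simp
qed

lemma l1_norm_nonneg: "0 \<le> l1_norm x"
  by (simp add: l1_norm_def sum_nonneg)

lemma l1_norm_vec_scale: "l1_norm (s *s x) = cmod s * l1_norm x"
  by (simp add: l1_norm_def norm_mult sum_distrib_left)

lemma norm_le_l1_norm: "norm x \<le> l1_norm x"
  unfolding norm_vec_def l1_norm_def by (rule L2_set_le_sum) simp

lemma tendsto_cdot:
  assumes "(f \<longlongrightarrow> a) F" "(g \<longlongrightarrow> b) F"
  shows "((\<lambda>x. cdot (f x) (g x)) \<longlongrightarrow> cdot a b) F"
  unfolding cdot_def by (intro tendsto_intros assms)

lemma tendsto_l1_norm:
  assumes "(f \<longlongrightarrow> a) F"
  shows "((\<lambda>x. l1_norm (f x)) \<longlongrightarrow> l1_norm a) F"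
  unfolding l1_norm_def by (intro tendsto_intros assms)

lemma bounded_linear_complex_matrix_vector_mult:
  fixes A :: "complex ^ 'a ^ 'b"
  shows "bounded_linear (\<lambda>x. A *v x)"
  unfolding linear_conv_bounded_linear[symmetric]
  by (rule linearI)
     (simp_all add: vec_eq_iff matrix_vector_mult_def distrib_left sum.distrib scaleR_sum_right)

lemma bounded_bilinear_vec_times:
  "bounded_bilinear (\<lambda>x y :: complex ^ 'a. x * y)"
  unfolding bilinear_conv_bounded_bilinear[symmetric] bilinear_def
  by (auto intro!: linearI simp: vec_eq_iff distrib_left distrib_right)

section \<open>Adjoints for the complex inner product\<close>

definition adjoint_matrix :: "complex ^ 'a ^ 'b \<Rightarrow> complex ^ 'b ^ 'a" where
  "adjoint_matrix A = (\<chi> a b. cnj (A $ b $ a))"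

definition cnj_vec :: "complex ^ 'a \<Rightarrow> complex ^ 'a" where
  "cnj_vec x = (\<chi> l. cnj (x $ l))"

lemma cdot_adjoint_matrix: "cdot (adjoint_matrix A *v x) y = cdot x (A *v y)"
proof -
  have "cdot (adjoint_matrix A *v x) y = (\<Sum>l\<in>UNIV. \<Sum>k\<in>UNIV. cnj (A $ k $ l) * x $ k * cnj (y $ l))"
    by (simp add: cdot_def adjoint_matrix_def matrix_vector_mult_def sum_distrib_right)
  also have "\<dots> = (\<Sum>k\<in>UNIV. \<Sum>l\<in>UNIV. cnj (A $ k $ l) * x $ k * cnj (y $ l))"
    by (rule sum.swap)
  also have "\<dots> = cdot x (A *v y)"
    by (simp add: cdot_def matrix_vector_mult_def sum_distrib_left mult_ac)
  finally show ?thesis .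
qed

lemma cdot_cnj_vec_times: "cdot (cnj_vec a * x) y = cdot x (a * y)"
  by (simp add: cdot_def cnj_vec_def mult_ac)

lemma tendsto_cnj_vec:
  assumes "(f \<longlongrightarrow> a) F"
  shows "((\<lambda>x. cnj_vec (f x)) \<longlongrightarrow> cnj_vec a) F"
  unfolding cnj_vec_def by (intro tendsto_intros assms)

section \<open>Real and complex gradients\<close>

lemma GDERIV_unique:
  assumes "GDERIV f x :> D" "GDERIV f x :> E"
  shows "D = E"
proof -
  have "(\<lambda>y. y \<bullet> D) = (\<lambda>y. y \<bullet> E)"
    using assms unfolding gderiv_def by (rule has_derivative_unique)
  then have "(D - E) \<bullet> D = (D - E) \<bullet> E"
    by (rule fun_cong)
  then have "(D - E) \<bullet> (D - E) = 0"
    by (simp add: inner_diff_right)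
  then show ?thesis by simp
qed

lemma real_gradient_eqI: "GDERIV f x :> D \<Longrightarrow> real_gradient f x = D"
  unfolding real_gradient_def by (blast intro: the_equality GDERIV_unique)

text \<open>The real inner product on complex vectors adds those of the real and of the imaginary
  parts, so the two parts of \<open>G\<close> are the partial gradients in the two real variables.
  Complex gradients can thus be computed with the usual derivative rules on a real inner product
  space.\<close>

lemma complex_gradient_eqI:
  assumes "GDERIV \<psi> w :> G"
  shows "complex_gradient \<psi> w = G"
proof -
  let ?c = "\<lambda>(x :: real ^ 'a) y :: real ^ 'a. (\<chi> l. Complex (x $ l) (y $ l)) :: complex ^ 'a"
  let ?wr = "\<chi> l. Re (w $ l)" and ?wi = "\<chi> l. Im (w $ l)"
  have w: "?c ?wr ?wi = w" by (simp add: vec_eq_iff)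
  have \<psi>: "(\<psi> has_derivative (\<lambda>y. y \<bullet> G)) (at (?c ?wr ?wi))"
    using assms unfolding gderiv_def w .
  \<comment> \<open>Splitting off the fixed part shows that both slices are affine.\<close>
  have c_sum: "?c x y = ?c x 0 + ?c 0 y" for x y
    by (simp add: vec_eq_iff complex_eq_iff)
  have br: "bounded_linear (\<lambda>x. ?c x 0)" and bi: "bounded_linear (\<lambda>y. ?c 0 y)"
    unfolding linear_conv_bounded_linear[symmetric]
    by (auto intro!: linearI simp: vec_eq_iff complex_eq_iff)
  have cr: "((\<lambda>x. ?c x ?wi) has_derivative (\<lambda>x. ?c x 0)) (at ?wr)"
    by (subst c_sum)
       (rule has_derivative_add_const[OF bounded_linear_imp_has_derivative[OF br]])
  have ci: "((\<lambda>y. ?c ?wr y) has_derivative (\<lambda>y. ?c 0 y)) (at ?wi)"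
    by (subst c_sum, subst add.commute)
       (rule has_derivative_add_const[OF bounded_linear_imp_has_derivative[OF bi]])
  have "GDERIV (\<lambda>x. \<psi> (?c x ?wi)) ?wr :> (\<chi> l. Re (G $ l))"
    using has_derivative_compose[OF cr \<psi>]
    by (simp add: gderiv_def inner_vec_def inner_complex_def)
  moreover have "GDERIV (\<lambda>y. \<psi> (?c ?wr y)) ?wi :> (\<chi> l. Im (G $ l))"
    using has_derivative_compose[OF ci \<psi>]
    by (simp add: gderiv_def inner_vec_def inner_complex_def)
  ultimately show ?thesis
    unfolding complex_gradient_def Let_def
    by (simp add: real_gradient_eqI vec_eq_iff)
qed

section \<open>Soft thresholding and convergence of descent sequences\<close>

text \<open>\<open>soft \<tau> a\<close> minimizes
  \<open>(cmod (s - a))\<^sup>2 + 2 * \<tau> * cmod s\<close> over \<open>s\<close>; the first claim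
  compares its value with the one at \<open>s = 0\<close>.\<close>

lemma soft_descent:
  assumes "0 \<le> \<tau>"
  shows "(cmod (soft \<tau> a - a))\<^sup>2 + 2 * \<tau> * cmod (soft \<tau> a) \<le> (cmod a)\<^sup>2"
    and "cmod (soft \<tau> a - a) \<le> \<tau>"
proof -
  have "(cmod (soft \<tau> a - a))\<^sup>2 + 2 * \<tau> * cmod (soft \<tau> a) \<le> (cmod a)\<^sup>2
    \<and> cmod (soft \<tau> a - a) \<le> \<tau>"
  proof (cases "cmod a > \<tau>")
    case True
    with assms have a: "cmod a > 0" by linarith
    have "soft \<tau> a - a = of_real (- \<tau> / cmod a) * a"
      using True a by (simp add: soft_def field_simps)
    then have 1: "cmod (soft \<tau> a - a) = \<tau>"
      using a assms by (simp only: norm_mult norm_of_real) (simp add: field_simps)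
    have 2: "cmod (soft \<tau> a) = cmod a - \<tau>"
      using True a by (simp add: soft_def norm_mult norm_divide flip: of_real_diff)
    \<comment> \<open>With the two moduli inserted, the descent inequality says exactly that this
      square is nonnegative.\<close>
    have "0 \<le> (cmod a - \<tau>)\<^sup>2" by simp
    then show ?thesis
      unfolding 1 2 by (simp add: power2_eq_square algebra_simps)
  qed (simp add: soft_def)
  then show "(cmod (soft \<tau> a - a))\<^sup>2 + 2 * \<tau> * cmod (soft \<tau> a) \<le> (cmod a)\<^sup>2"
    and "cmod (soft \<tau> a - a) \<le> \<tau>" by auto
qed

text \<open>Completing the square turns a quadratic with slope \<open>c\<close>, curvature
  \<open>B\<close> and penalty weight \<open>t\<close> into the problem solved by
  \<open>soft\<close>, centred at \<open>- c / B\<close>. The first bound compares with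
  \<open>s = 0\<close>; the second is the first-order condition, where \<open>c + s * B\<close> is
  the slope of the smooth part at the minimizer.\<close>

lemma soft_minimizes:
  fixes B t :: real and c :: complex
  assumes "B > 0" "t \<ge> 0"
  defines "s \<equiv> soft (t / B) (- c / of_real B)"
  shows "Re (cnj s * c) + B / 2 * (cmod s)\<^sup>2 + t * cmod s \<le> 0"
    and "cmod (c + s * of_real B) \<le> t"
proof -
  let ?z = "- c / of_real B"
  have c: "c = - of_real B * ?z" using assms by simp
  have "Re (cnj s * c) + B / 2 * (cmod s)\<^sup>2 + t * cmod s
      = B / 2 * ((cmod (s - ?z))\<^sup>2 + 2 * (t / B) * cmod s - (cmod ?z)\<^sup>2)"
  proof -
    have "(cmod (s - ?z))\<^sup>2 = (cmod s)\<^sup>2 - 2 * Re (cnj s * ?z) + (cmod ?z)\<^sup>2"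
      unfolding cmod_power2 by (simp add: power2_eq_square algebra_simps add_divide_distrib)
    moreover have "Re (cnj s * c) = - B * Re (cnj s * ?z)"
      using assms(1) by simp
    ultimately show ?thesis
      using assms(1) by (simp add: algebra_simps add_divide_distrib)
  qed
  also have "\<dots> \<le> 0"
    using soft_descent(1)[of "t / B" ?z] assms by (intro mult_nonneg_nonpos) (auto simp: s_def)
  finally show "Re (cnj s * c) + B / 2 * (cmod s)\<^sup>2 + t * cmod s \<le> 0" .
  have "c + s * of_real B = of_real B * (s - ?z)"
    using assms(1) by (simp add: field_simps)
  then have "cmod (c + s * of_real B) = B * cmod (s - ?z)"
    using assms(1) by (simp add: norm_mult)
  also have "\<dots> \<le> B * (t / B)"
    using soft_descent(2)[of "t / B" ?z] assms by (intro mult_left_mono) (auto simp: s_def)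
  finally show "cmod (c + s * of_real B) \<le> t" using assms(1) by simp
qed

text \<open>Being decreasing and bounded below, \<open>f\<close> converges, so its decrements are
  summable. They dominate the step lengths, and completeness makes the telescoping series of steps
  converge.\<close>

lemma convergent_if_steps_bounded_by_decrease:
  fixes z :: "nat \<Rightarrow> 'a::banach" and f :: "nat \<Rightarrow> real"
  assumes "c > 0" and f: "\<And>k. 0 \<le> f k" and dec: "\<And>k. c * norm (z (Suc k) - z k) \<le> f k - f (Suc k)"
  shows "convergent z"
proof -
  have "decseq f"
    by (rule decseq_SucI)
       (use dec \<open>c > 0\<close> in \<open>smt (verit) mult_nonneg_nonneg norm_ge_zero\<close>)
  then obtain L where "f \<longlonglongrightarrow> L"
    using decseq_convergent[of f 0] f by blast
  then have "summable (\<lambda>k. f k - f (Suc k))"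
    using telescope_summable' by blast
  then have "summable (\<lambda>k. (f k - f (Suc k)) / c)"
    by (rule summable_divide)
  moreover have "norm (z (Suc k) - z k) \<le> (f k - f (Suc k)) / c" for k
    using dec[of k] \<open>c > 0\<close> by (simp add: field_simps)
  ultimately have "summable (\<lambda>k. z (Suc k) - z k)"
    by (rule summable_comparison_test'[where N = 0])
  then have "convergent (\<lambda>n. \<Sum>k<n. z (Suc k) - z k)"
    using summable_iff_convergent by blast
  then have "convergent (\<lambda>n. (z n - z 0) + z 0)"
    unfolding sum_lessThan_telescope by (intro convergent_add) (auto simp: convergent_const)
  then show ?thesis by simp
qed

text \<open>The numerator of the Polak-Ribiere coefficient contains the difference of consecutive
  gradients, while the denominator stays away from \<open>0\<close>. Once the coefficient is below
  \<open>1 / 2\<close> the directions remain bounded, so the correction term vanishes in the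
  limit.\<close>

lemma direction_tendsto:
  fixes g v :: "nat \<Rightarrow> complex ^ 'a"
  assumes g: "g \<longlonglongrightarrow> G" and "G \<noteq> 0"
    and v: "\<And>k. v (Suc k) = ircsi.direction (g (Suc k)) (g k) (v k)"
  shows "v \<longlonglongrightarrow> G"
proof -
  define b where "b k = Re (cdot (g (Suc k)) (g (Suc k) - g k)) / (norm (g k))\<^sup>2" for k
  have gS: "(\<lambda>k. g (Suc k)) \<longlonglongrightarrow> G" using g by (rule LIMSEQ_Suc)
  have "b \<longlonglongrightarrow> Re (cdot G (G - G)) / (norm G)\<^sup>2"
    unfolding b_def by (intro tendsto_intros tendsto_cdot g gS) (use \<open>G \<noteq> 0\<close> in simp)
  then have b: "b \<longlonglongrightarrow> 0" by (simp add: cdot_def)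
  \<comment> \<open>From some index on, the restart branch of \<open>direction\<close> no longer
    occurs.\<close>
  have "\<forall>\<^sub>F k in sequentially. g k \<noteq> 0"
    using g \<open>G \<noteq> 0\<close> tendsto_imp_eventually_ne by blast
  then have step: "\<forall>\<^sub>F k in sequentially. v (Suc k) = g (Suc k) + b k *\<^sub>R v k"
    by eventually_elim (simp add: v ircsi.direction_def b_def)
  moreover have "\<forall>\<^sub>F k in sequentially. \<bar>b k\<bar> < 1 / 2"
    using order_tendstoD(2)[OF tendsto_rabs[OF b], of "1 / 2"] by simp
  ultimately have "\<forall>\<^sub>F k in sequentially. \<bar>b k\<bar> < 1 / 2 \<and> v (Suc k) = g (Suc k) + b k *\<^sub>R v k"
    by eventually_elim simp
  then obtain K where K: "\<And>k. k \<ge> K \<Longrightarrow> \<bar>b k\<bar> < 1 / 2 \<and> v (Suc k) = g (Suc k) + b k *\<^sub>R v k"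
    unfolding eventually_sequentially by blast
  obtain C where C: "\<And>k. norm (g k) \<le> C"
    using convergent_imp_Bseq[OF convergentI[OF g]] by (meson BseqE)
  \<comment> \<open>The norms obey \<open>x' \<le> C + x / 2\<close>, whose fixed point is
    \<open>2 * C\<close>; hence this maximum is never exceeded.\<close>
  have "norm (v k) \<le> max (norm (v K)) (2 * C)" if "k \<ge> K" for k
    using that
  proof (induction k rule: dec_induct)
    case (step k)
    have "norm (v (Suc k)) \<le> norm (g (Suc k)) + \<bar>b k\<bar> * norm (v k)"
      using K[OF step.hyps(1)] norm_triangle_ineq[of "g (Suc k)" "b k *\<^sub>R v k"] by simp
    also have "\<dots> \<le> C + 1 / 2 * norm (v k)"
      using C K[OF step.hyps(1)] by (intro add_mono mult_right_mono) auto
    finally show ?case using step.IH by linarith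
  qed simp
  then have "Bseq v"
    by (intro BfunI[where K = "max (norm (v K)) (2 * C)"]) (auto simp: eventually_sequentially)
  then have "(\<lambda>k. b k *\<^sub>R v k) \<longlonglongrightarrow> 0"
    using b bounded_bilinear.Zfun_prod_Bfun[OF bounded_bilinear_scaleR] by (simp add: tendsto_Zfun_iff)
  with gS have "(\<lambda>k. g (Suc k) + b k *\<^sub>R v k) \<longlonglongrightarrow> G + 0"
    by (rule tendsto_add)
  then have "(\<lambda>k. v (Suc k)) \<longlonglongrightarrow> G"
    using step by (simp add: filterlim_cong[OF refl refl step])
  then show ?thesis by (rule LIMSEQ_imp_Suc)
qed

section \<open>Gradients of the objective\<close>

lemma sum_stacked_index:
  fixes f :: "'j::finite \<times> 'm::finite + 'm \<Rightarrow> 'a::comm_monoid_add"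
  shows "(\<Sum>i\<in>UNIV. f i) = (\<Sum>j\<in>UNIV. \<Sum>l\<in>UNIV. f (Inl (j, l))) + (\<Sum>l\<in>UNIV. f (Inr l))"
  by (simp add: UNIV_Plus_UNIV[symmetric] sum.Plus UNIV_Times_UNIV[symmetric] sum.cartesian_product
      del: UNIV_Plus_UNIV UNIV_Times_UNIV)

lemma omega_part_stack [simp]: "omega_part (stack \<omega> m) = \<omega>"
  and m_part_stack [simp]: "m_part (stack \<omega> m) = m"
  by (simp_all add: omega_part_def m_part_def stack_def vec_eq_iff)

lemma stack_diff: "stack \<omega> m - stack \<omega>' m' = stack (\<omega> - \<omega>') (m - m')"
  by (auto simp: stack_def vec_eq_iff split: sum.split)

lemma inner_stack: "z \<bullet> stack \<omega> m = (\<Sum>j\<in>UNIV. omega_part z $ j \<bullet> \<omega> $ j) + m_part z \<bullet> m"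
  by (simp add: inner_vec_def sum_stacked_index omega_part_def m_part_def stack_def)

lemma l1_norm_stack: "l1_norm (stack \<omega> m) = (\<Sum>j\<in>UNIV. l1_norm (\<omega> $ j)) + l1_norm m"
  by (simp add: l1_norm_def sum_stacked_index stack_def)

lemma bounded_linear_omega_part: "bounded_linear (\<lambda>z. omega_part z $ j)"
  and bounded_linear_m_part: "bounded_linear m_part"
  unfolding linear_conv_bounded_linear[symmetric]
  by (auto intro!: linearI simp: omega_part_def m_part_def vec_eq_iff)

text \<open>The hypotheses match what the two half steps deliver: Euclidean bounds for the gradient
  blocks in \<open>\<omega>\<close>, entrywise bounds for the one in \<open>m\<close>.\<close>

lemma max_norm_stack_le:
  assumes "\<And>j. norm (\<omega> $ j) \<le> e" "\<And>l. cmod (m $ l) \<le> e"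
  shows "max_norm (stack \<omega> m) \<le> e"
  unfolding max_norm_def
proof (rule Max.boundedI; clarsimp?)
  fix i
  show "cmod (stack \<omega> m $ i) \<le> e"
    using assms
    by (auto simp: stack_def split: sum.split
        intro: order_trans[OF Finite_Cartesian_Product.norm_nth_le])
qed

text \<open>For fixed \<open>\<omega>\<close> the state term at one grid point is such a sum in the
  scalar unknown \<open>x\<close>. The expansion is exact, and its linear coefficient is an entry of
  the contrast gradient.\<close>

lemma weighted_squares_expand:
  fixes u w :: "'j::finite \<Rightarrow> complex" and \<eta> :: "'j \<Rightarrow> real"
  shows "(\<Sum>j\<in>UNIV. \<eta> j * (cmod ((x + \<delta>) * u j - w j))\<^sup>2)
    = (\<Sum>j\<in>UNIV. \<eta> j * (cmod (x * u j - w j))\<^sup>2)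
      + Re (cnj \<delta> * (\<Sum>j\<in>UNIV. of_real (2 * \<eta> j) * (cnj (u j) * (x * u j - w j))))
      + (\<Sum>j\<in>UNIV. \<eta> j * (cmod (u j))\<^sup>2) * (cmod \<delta>)\<^sup>2"
proof -
  have *: "(cmod ((x + \<delta>) * u - w))\<^sup>2
      = (cmod (x * u - w))\<^sup>2 + 2 * Re (cnj \<delta> * (cnj u * (x * u - w))) + (cmod u)\<^sup>2 * (cmod \<delta>)\<^sup>2"
    for u w unfolding cmod_power2 by (simp add: power2_eq_square algebra_simps)
  show ?thesis
    unfolding * sum_distrib_left sum_distrib_right Re_sum sum.distrib[symmetric]
    by (rule sum.cong) (simp_all add: algebra_simps)
qed

section \<open>Closed forms of the gradients\<close>

context ircsi
begin

definition state_residual :: "'j \<Rightarrow> complex ^ 'm \<Rightarrow> complex ^ 'm \<Rightarrow> complex ^ 'm" where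
  "state_residual j w m = m * ui j + m * (T *v w) - w"

definition data_residual :: "'j \<Rightarrow> complex ^ 'm \<Rightarrow> complex ^ 'q" where
  "data_residual j w = ud j - Tinf *v w"

text \<open>Gradient in one block \<open>w\<close>: the adjoints of the residual derivatives
  \<open>m * (T *v v) - v\<close> and \<open>- (Tinf *v v)\<close>, applied to the
  residuals.\<close>

definition state_gradient :: "'j \<Rightarrow> complex ^ 'm \<Rightarrow> complex ^ 'm \<Rightarrow> complex ^ 'm" where
  "state_gradient j w m =
    (2 * \<eta>\<^sub>s j) *\<^sub>R (adjoint_matrix T *v (cnj_vec m * state_residual j w m) - state_residual j w m)
    - (2 * \<eta>\<^sub>d j) *\<^sub>R (adjoint_matrix Tinf *v data_residual j w)"

text \<open>Gradient in \<open>m\<close>: the state residual is affine in \<open>m\<close>, the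
  entrywise factor being the total field \<open>ui j + T *v (\<omega> $ j)\<close>.\<close>

definition contrast_gradient :: "complex ^ 'm ^ 'j \<Rightarrow> complex ^ 'm \<Rightarrow> complex ^ 'm" where
  "contrast_gradient \<omega> m =
    (\<Sum>j\<in>UNIV. (2 * \<eta>\<^sub>s j) *\<^sub>R (cnj_vec (ui j + T *v (\<omega> $ j)) * state_residual j (\<omega> $ j) m))"

text \<open>The denominator \<open>B\<close> of the step size, which is the second derivative of
  \<open>F_part\<close> along \<open>v\<close>; see \<open>F_part_line\<close>.\<close>

definition curvature :: "'j \<Rightarrow> complex ^ 'm \<Rightarrow> complex ^ 'm \<Rightarrow> real" where
  "curvature j m v = 2 * \<eta>\<^sub>s j * (norm (v - m * (T *v v)))\<^sup>2 + 2 * \<eta>\<^sub>d j * (norm (Tinf *v v))\<^sup>2"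

lemma F_part_residuals:
  "F_part j w m = \<eta>\<^sub>s j * (norm (state_residual j w m))\<^sup>2 + \<eta>\<^sub>d j * (norm (data_residual j w))\<^sup>2"
  by (simp add: F_part_def state_residual_def data_residual_def)

text \<open>Moving the adjoints to the other side expresses slopes through residuals and their
  derivatives; the later computations use only this form.\<close>

lemma cdot_state_gradient:
  "cdot (state_gradient j w m) v =
    of_real (2 * \<eta>\<^sub>s j) * cdot (state_residual j w m) (m * (T *v v) - v)
    - of_real (2 * \<eta>\<^sub>d j) * cdot (data_residual j w) (Tinf *v v)"
  unfolding state_gradient_def
  by (simp add: cdot_diff_left cdot_diff_right cdot_scaleR_left cdot_adjoint_matrix cdot_cnj_vec_times
      del: of_real_mult)

lemma inner_contrast_gradient:
  "k \<bullet> contrast_gradient \<omega> m =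
    (\<Sum>j\<in>UNIV. 2 * \<eta>\<^sub>s j * (state_residual j (\<omega> $ j) m \<bullet> (k * (ui j + T *v (\<omega> $ j)))))"
proof -
  have "k \<bullet> (cnj_vec u * r) = r \<bullet> (k * u)" for u r :: "complex ^ 'm"
    using cdot_cnj_vec_times[of u r k] by (metis inner_commute inner_eq_Re_cdot mult.commute)
  then show ?thesis
    by (simp add: contrast_gradient_def inner_sum_right)
qed

lemma GDERIV_F_stacked:
  "GDERIV F_stacked z :> stack (\<chi> j. state_gradient j (omega_part z $ j) (m_part z))
                               (contrast_gradient (omega_part z) (m_part z))"
proof -
  note [derivative_intros] =
    bounded_linear.has_derivative[OF bounded_linear_omega_part]
    bounded_linear.has_derivative[OF bounded_linear_m_part]
    bounded_linear.has_derivative[OF bounded_linear_complex_matrix_vector_mult]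
    bounded_bilinear.FDERIV[OF bounded_bilinear_vec_times]
  let ?w = "\<lambda>j. omega_part z $ j" and ?m = "m_part z"
  \<comment> \<open>The product rule separates the variation of \<open>m\<close>, which yields the
    contrast gradient, from that of \<open>\<omega>\<close>, which yields the state
    gradients.\<close>
  let ?dr = "\<lambda>j k. m_part k * (ui j + T *v ?w j) + (?m * (T *v (omega_part k $ j)) - omega_part k $ j)"
  have r: "((\<lambda>z. state_residual j (omega_part z $ j) (m_part z)) has_derivative ?dr j) (at z)" for j
    unfolding state_residual_def
    by (rule derivative_eq_intros refl)+ (simp add: fun_eq_iff algebra_simps)
  have t: "((\<lambda>z. data_residual j (omega_part z $ j)) has_derivative
      (\<lambda>k. - (Tinf *v (omega_part k $ j)))) (at z)" for j
    unfolding data_residual_def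
    by (rule derivative_eq_intros refl)+ simp
  have "(F_stacked has_derivative (\<lambda>k. \<Sum>j\<in>UNIV.
      2 * \<eta>\<^sub>s j * (state_residual j (?w j) ?m \<bullet> ?dr j k)
      + 2 * \<eta>\<^sub>d j * (data_residual j (?w j) \<bullet> (- (Tinf *v (omega_part k $ j)))))) (at z)"
    unfolding F_stacked_def[abs_def] F_def F_part_residuals power2_norm_eq_inner
    by (rule derivative_eq_intros r t refl)+ (simp add: inner_commute algebra_simps)
  moreover have "(\<Sum>j\<in>UNIV. 2 * \<eta>\<^sub>s j * (state_residual j (?w j) ?m \<bullet> ?dr j k)
      + 2 * \<eta>\<^sub>d j * (data_residual j (?w j) \<bullet> (- (Tinf *v (omega_part k $ j)))))
    = k \<bullet> stack (\<chi> j. state_gradient j (?w j) ?m) (contrast_gradient (omega_part z) ?m)" for k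
  proof -
    have "omega_part k $ j \<bullet> state_gradient j (?w j) ?m =
        2 * \<eta>\<^sub>s j * (state_residual j (?w j) ?m \<bullet> (?m * (T *v (omega_part k $ j)) - omega_part k $ j))
        + 2 * \<eta>\<^sub>d j * (data_residual j (?w j) \<bullet> (- (Tinf *v (omega_part k $ j))))" for j
      unfolding inner_commute[of "omega_part k $ j"] inner_minus_right
      unfolding inner_eq_Re_cdot cdot_state_gradient by simp
    then show ?thesis
      unfolding inner_stack inner_contrast_gradient inner_add_right sum.distrib[symmetric]
      by (intro sum.cong) (simp_all add: algebra_simps inner_add_right)
  qed
  ultimately show ?thesis
    unfolding gderiv_def by simp
qed

text \<open>Varying one block is an affine embedding into the stacked space, so the chain rule
  applied to \<open>GDERIV_F_stacked\<close> picks out that block of the full gradient.\<close>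

lemma grad_omega_eq: "grad_omega \<omega> m j = state_gradient j (\<omega> $ j) m"
proof -
  let ?e = "\<lambda>w :: complex ^ 'm. stack (\<chi> i. if i = j then w else \<omega> $ i) m"
  let ?l = "\<lambda>w :: complex ^ 'm. stack (\<chi> i. if i = j then w else (0 :: complex ^ 'm)) 0"
  have e: "?e w = ?l w + ?e 0" for w
    by (auto simp: stack_def vec_eq_iff split: sum.split)
  have "bounded_linear ?l"
    unfolding linear_conv_bounded_linear[symmetric]
    by (auto intro!: linearI simp: stack_def vec_eq_iff split: sum.split)
  then have "((\<lambda>w. ?l w + ?e 0) has_derivative ?l) (at (\<omega> $ j))"
    by (intro has_derivative_add_const bounded_linear_imp_has_derivative)
  then have "(?e has_derivative ?l) (at (\<omega> $ j))"
    unfolding e[symmetric] .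
  note has_derivative_compose[OF this GDERIV_F_stacked[unfolded gderiv_def]]
  moreover have "?l k \<bullet> stack (\<chi> i. state_gradient i (omega_part (?e (\<omega> $ j)) $ i) (m_part (?e (\<omega> $ j)))) G
      = k \<bullet> state_gradient j (\<omega> $ j) m" for k G
    by (simp add: inner_stack if_distrib[of "\<lambda>x. x \<bullet> _"] cong: if_cong)
  ultimately have "GDERIV (\<lambda>w. F_stacked (?e w)) (\<omega> $ j) :> state_gradient j (\<omega> $ j) m"
    unfolding gderiv_def by simp
  then show ?thesis
    unfolding grad_omega_def by (simp add: F_stacked_def complex_gradient_eqI)
qed

section \<open>The objective along search lines and at single grid points\<close>

lemma state_residual_line:
  "state_residual j (w + s *s v) m = state_residual j w m + s *s (m * (T *v v) - v)"
  by (simp add: state_residual_def matrix_vector_right_distrib vector_scalar_commute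
      vec_eq_iff algebra_simps)

lemma data_residual_line:
  "data_residual j (w + s *s v) = data_residual j w + (- s) *s (Tinf *v v)"
  by (simp add: data_residual_def matrix_vector_right_distrib vector_scalar_commute
      vec_eq_iff algebra_simps)

text \<open>Both residuals are affine in \<open>w\<close>, so the expansion in the complex step
  \<open>s\<close> is exact.\<close>

lemma F_part_line:
  "F_part j (w + s *s v) m =
    F_part j w m + Re (cnj s * cdot (state_gradient j w m) v) + curvature j m v / 2 * (cmod s)\<^sup>2"
  unfolding F_part_residuals state_residual_line data_residual_line norm_add_vec_scale_squared
    cdot_state_gradient curvature_def norm_minus_commute[of v]
  by (simp add: algebra_simps)

text \<open>The slope at the new point takes the form \<open>c + s * B\<close> bounded in
  \<open>soft_minimizes\<close>.\<close>

lemma cdot_state_gradient_line: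
  "cdot (state_gradient j (w + s *s v) m) v =
    cdot (state_gradient j w m) v + s * of_real (curvature j m v)"
  unfolding cdot_state_gradient state_residual_line data_residual_line cdot_add_left
    cdot_vec_scale_left cdot_self curvature_def norm_minus_commute[of v]
  by (simp add: algebra_simps)

lemma contrast_gradient_nth:
  "contrast_gradient \<omega> m $ l =
    (\<Sum>j\<in>UNIV. of_real (2 * \<eta>\<^sub>s j) * (cnj ((ui j + T *v (\<omega> $ j)) $ l)
      * (m $ l * (ui j + T *v (\<omega> $ j)) $ l - \<omega> $ j $ l)))"
  unfolding contrast_gradient_def sum_component
  by (rule sum.cong)
     (simp_all add: cnj_vec_def state_residual_def scaleR_conv_of_real[where 'a = complex] algebra_simps)

text \<open>For fixed \<open>\<omega>\<close> the problem in \<open>m\<close> decouples into scalar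
  problems, one per grid point; the data term is constant.\<close>

lemma F_componentwise:
  "F \<omega> m = (\<Sum>l\<in>UNIV. \<Sum>j\<in>UNIV. \<eta>\<^sub>s j * (cmod (m $ l * (ui j + T *v (\<omega> $ j)) $ l - \<omega> $ j $ l))\<^sup>2)
    + (\<Sum>j\<in>UNIV. \<eta>\<^sub>d j * (norm (data_residual j (\<omega> $ j)))\<^sup>2)"
proof -
  have "(norm (state_residual j (\<omega> $ j) m))\<^sup>2 =
      (\<Sum>l\<in>UNIV. (cmod (m $ l * (ui j + T *v (\<omega> $ j)) $ l - \<omega> $ j $ l))\<^sup>2)" for j
    by (simp add: norm_vec_def L2_set_def sum_nonneg state_residual_def algebra_simps)
  then show ?thesis
    unfolding F_def F_part_residuals sum.distrib
    by (simp only: sum_distrib_left) (subst sum.swap, rule refl)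
qed

end

section \<open>The iteration\<close>

locale ircsi_positive = ircsi \<kappa> h p xhat d ud \<eta>\<^sub>s \<eta>\<^sub>d \<gamma> \<beta>
  for \<kappa> h :: real
    and p :: "'m::finite \<Rightarrow> int ^ 'n"
    and xhat :: "'q::finite \<Rightarrow> real ^ 'n"
    and d :: "'j::finite \<Rightarrow> real ^ 'n"
    and ud :: "'j \<Rightarrow> complex ^ 'q"
    and \<eta>\<^sub>s \<eta>\<^sub>d :: "'j \<Rightarrow> real"
    and \<gamma> \<beta> :: real +
  assumes eta_s_pos: "\<And>j. \<eta>\<^sub>s j > 0" and eta_d_pos: "\<And>j. \<eta>\<^sub>d j > 0"
    and gamma_pos: "\<gamma> > 0" and beta_pos: "\<beta> > 0"
begin

section \<open>Descent and optimality of the two half steps\<close>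

lemma curvature_nonneg: "0 \<le> curvature j m v"
  using eta_s_pos[of j] eta_d_pos[of j] by (simp add: curvature_def)

text \<open>Positive weights force both residual derivatives along \<open>v\<close> to vanish. Hence
  the default step \<open>0\<close> for \<open>B = 0\<close> also satisfies the optimality
  bound.\<close>

lemma cdot_state_gradient_eq_0:
  assumes "curvature j m v = 0"
  shows "cdot (state_gradient j w m) v = 0"
proof -
  have "v - m * (T *v v) = 0 \<and> Tinf *v v = 0"
    using assms eta_s_pos[of j] eta_d_pos[of j]
    by (simp add: curvature_def add_nonneg_eq_0_iff)
  then have "m * (T *v v) - v = 0" "Tinf *v v = 0" by simp_all
  then show ?thesis by (simp add: cdot_state_gradient) (simp add: cdot_def)
qed

lemma step_size_eq:
  "step_size j \<omega> m v = (if curvature j m v = 0 then 0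
    else soft (\<gamma> * l1_norm v / curvature j m v)
           (- cdot (state_gradient j (\<omega> $ j) m) v / of_real (curvature j m v)))"
  by (simp add: step_size_def curvature_def grad_omega_eq Let_def)

lemma omega_update_nth: "omega_update \<omega> m v $ j = \<omega> $ j + step_size j \<omega> m (v $ j) *s (v $ j)"
  by (simp add: omega_update_def)

text \<open>Both claims are \<open>soft_minimizes\<close> for the exact quadratic along the search
  line. The optimality bound refers to the new \<open>\<omega>\<close> but still to the old
  \<open>m\<close>.\<close>

lemma
  shows omega_update_descent: "F_part j (omega_update \<omega> m v $ j) m
      + \<gamma> * l1_norm (omega_update \<omega> m v $ j - \<omega> $ j) \<le> F_part j (\<omega> $ j) m"
    and omega_update_optimality:
      "cmod (cdot (state_gradient j (omega_update \<omega> m v $ j) m) (v $ j)) \<le> \<gamma> * l1_norm (v $ j)"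
proof -
  define B where "B = curvature j m (v $ j)"
  define c where "c = cdot (state_gradient j (\<omega> $ j) m) (v $ j)"
  define s where "s = step_size j \<omega> m (v $ j)"
  have t: "0 \<le> \<gamma> * l1_norm (v $ j)"
    using gamma_pos by (simp add: l1_norm_nonneg)
  have *: "Re (cnj s * c) + B / 2 * (cmod s)\<^sup>2 + \<gamma> * l1_norm (v $ j) * cmod s \<le> 0
      \<and> cmod (c + s * of_real B) \<le> \<gamma> * l1_norm (v $ j)"
  proof (cases "B = 0")
    case True
    then show ?thesis
      using t cdot_state_gradient_eq_0[of j m "v $ j"] by (simp add: s_def c_def B_def step_size_eq)
  next
    case False
    then have "B > 0" using curvature_nonneg[of j m "v $ j"] by (simp add: B_def)
    moreover have "s = soft (\<gamma> * l1_norm (v $ j) / B) (- c / of_real B)"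
      using False by (simp add: s_def c_def B_def step_size_eq)
    ultimately show ?thesis
      using soft_minimizes[of B "\<gamma> * l1_norm (v $ j)" c] t by simp
  qed
  then show "F_part j (omega_update \<omega> m v $ j) m
      + \<gamma> * l1_norm (omega_update \<omega> m v $ j - \<omega> $ j) \<le> F_part j (\<omega> $ j) m"
    unfolding omega_update_nth F_part_line add_diff_cancel_left' l1_norm_vec_scale
    by (simp add: s_def c_def B_def mult_ac)
  show "cmod (cdot (state_gradient j (omega_update \<omega> m v $ j) m) (v $ j)) \<le> \<gamma> * l1_norm (v $ j)"
    using * unfolding omega_update_nth cdot_state_gradient_line by (simp add: s_def c_def B_def)
qed

text \<open>Each grid point gives a scalar instance of \<open>soft_minimizes\<close> for the
  increment \<open>\<delta> l\<close>; summing these instances gives the descent.\<close>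

lemma
  shows m_update_descent: "F \<omega> (m_update \<omega> m) + \<beta> * l1_norm (m_update \<omega> m - m) \<le> F \<omega> m"
    and m_update_optimality: "cmod (contrast_gradient \<omega> (m_update \<omega> m) $ l) \<le> \<beta>"
proof -
  define u where "u l j = (ui j + T *v (\<omega> $ j)) $ l" for l j
  define A where "A l = (\<Sum>j\<in>UNIV. \<eta>\<^sub>s j * (cmod (u l j))\<^sup>2)" for l
  define G where "G l x = (\<Sum>j\<in>UNIV. of_real (2 * \<eta>\<^sub>s j) * (cnj (u l j) * (x * u l j - \<omega> $ j $ l)))" for l x
  define \<delta> where "\<delta> l = m_update \<omega> m $ l - m $ l" for l
  have A: "complex_of_real (A l) = (\<Sum>j\<in>UNIV. of_real (\<eta>\<^sub>s j) * cnj (u l j) * u l j)" for l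
    by (simp add: A_def complex_norm_square mult_ac del: of_real_power)
  have G: "G l x = 2 * (of_real (A l) * x - (\<Sum>j\<in>UNIV. of_real (\<eta>\<^sub>s j) * cnj (u l j) * \<omega> $ j $ l))" for l x
    unfolding G_def A by (simp add: sum_distrib_left sum_distrib_right sum_subtractf[symmetric] algebra_simps)
  have *: "Re (cnj (\<delta> l) * G l (m $ l)) + A l * (cmod (\<delta> l))\<^sup>2 + \<beta> * cmod (\<delta> l) \<le> 0
      \<and> cmod (G l (m $ l + \<delta> l)) \<le> \<beta>" for l
  proof (cases "\<forall>j. u l j = 0")
    \<comment> \<open>Without a total field at this point the objective ignores the entry: the
      update keeps it and its gradient is \<open>0\<close>.\<close>
    case True
    then have "\<delta> l = 0" by (simp add: \<delta>_def m_update_def u_def)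
    then show ?thesis using True beta_pos by (simp add: G_def)
  next
    case False
    then obtain i where "u l i \<noteq> 0" by blast
    then have "A l > 0"
      unfolding A_def using eta_s_pos
      by (intro sum_pos2[of _ i]) (auto simp: less_imp_le)
    moreover from this have "- G l (m $ l) / of_real (2 * A l) =
        (\<Sum>j\<in>UNIV. of_real (\<eta>\<^sub>s j) * cnj (u l j) * \<omega> $ j $ l) / of_real (A l) - m $ l"
      unfolding G by (simp add: field_simps)
    \<comment> \<open>The quadratic term is \<open>A l * (cmod (\<delta> l))\<^sup>2\<close>, so the
      curvature is \<open>2 * A l\<close>; this explains the threshold
      \<open>\<beta> / (2 * A l)\<close>.\<close>
    then have "\<delta> l = soft (\<beta> / (2 * A l)) (- G l (m $ l) / of_real (2 * A l))"
      using False by (auto simp: \<delta>_def m_update_def Let_def A_def u_def)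
    ultimately show ?thesis
      using soft_minimizes[of "2 * A l" \<beta> "G l (m $ l)"] beta_pos
      by (simp add: G algebra_simps)
  qed
  have m: "m_update \<omega> m $ l = m $ l + \<delta> l" for l by (simp add: \<delta>_def)
  have "F \<omega> (m_update \<omega> m) + \<beta> * l1_norm (m_update \<omega> m - m)
      = F \<omega> m + (\<Sum>l\<in>UNIV. Re (cnj (\<delta> l) * G l (m $ l)) + A l * (cmod (\<delta> l))\<^sup>2 + \<beta> * cmod (\<delta> l))"
    unfolding F_componentwise m weighted_squares_expand u_def[symmetric] G_def[symmetric] A_def[symmetric]
    by (simp add: sum.distrib sum_distrib_left l1_norm_def m)
  also have "\<dots> \<le> F \<omega> m"
    using * by (simp add: sum_nonpos)
  finally show "F \<omega> (m_update \<omega> m) + \<beta> * l1_norm (m_update \<omega> m - m) \<le> F \<omega> m" .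
  show "cmod (contrast_gradient \<omega> (m_update \<omega> m) $ l) \<le> \<beta>"
    using *[of l] unfolding contrast_gradient_nth m G_def u_def by simp
qed

lemma F_nonneg: "0 \<le> F \<omega> m"
  unfolding F_def F_part_def
  by (intro sum_nonneg add_nonneg_nonneg mult_nonneg_nonneg)
     (simp_all add: less_imp_le[OF eta_s_pos] less_imp_le[OF eta_d_pos])

section \<open>Continuity of the gradients\<close>

lemma tendsto_state_gradient:
  assumes "(w \<longlongrightarrow> w') net" "(m \<longlongrightarrow> m') net"
  shows "((\<lambda>x. state_gradient j (w x) (m x)) \<longlongrightarrow> state_gradient j w' m') net"
  unfolding state_gradient_def state_residual_def data_residual_def
  by (intro tendsto_intros tendsto_cnj_vec assms
      bounded_bilinear.tendsto[OF bounded_bilinear_vec_times]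
      bounded_linear.tendsto[OF bounded_linear_complex_matrix_vector_mult])

lemma tendsto_contrast_gradient:
  assumes "(\<omega> \<longlongrightarrow> \<omega>') net" "(m \<longlongrightarrow> m') net"
  shows "((\<lambda>x. contrast_gradient (\<omega> x) (m x)) \<longlongrightarrow> contrast_gradient \<omega>' m') net"
  unfolding contrast_gradient_def state_residual_def
  by (intro tendsto_intros tendsto_cnj_vec assms
      bounded_bilinear.tendsto[OF bounded_bilinear_vec_times]
      bounded_linear.tendsto[OF bounded_linear_complex_matrix_vector_mult])

section \<open>The iterates for fixed initial vectors\<close>

context
  fixes \<omega>0 :: "complex ^ 'm ^ 'j" and m0 :: "complex ^ 'm"
begin

definition "omega_seq k = fst (state \<omega>0 m0 k)"
definition "m_seq k = fst (snd (state \<omega>0 m0 k))"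
definition "v_seq k = snd (snd (state \<omega>0 m0 k))"

lemma seq_Suc:
  "omega_seq (Suc k) = omega_update (omega_seq k) (m_seq k) (v_seq k)"
  "m_seq (Suc k) = m_update (omega_seq (Suc k)) (m_seq k)"
  "v_seq (Suc k) $ j = direction (state_gradient j (omega_seq (Suc k) $ j) (m_seq (Suc k)))
     (state_gradient j (omega_seq k $ j) (m_seq k)) (v_seq k $ j)"
  by (simp_all add: omega_seq_def m_seq_def v_seq_def grad_omega_eq Let_def split: prod.split)

lemma iterate_eq: "iterate \<omega>0 m0 k = stack (omega_seq k) (m_seq k)"
  by (simp add: iterate_def omega_seq_def m_seq_def split: prod.split)

text \<open>The two descents chain through the intermediate point with new \<open>\<omega>\<close>
  and old \<open>m\<close>. The Euclidean step length is at most the sum of the two penalties'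
  norms.\<close>

lemma iterate_descent:
  "min \<gamma> \<beta> * norm (iterate \<omega>0 m0 (Suc k) - iterate \<omega>0 m0 k)
    \<le> F (omega_seq k) (m_seq k) - F (omega_seq (Suc k)) (m_seq (Suc k))"
proof -
  let ?d\<omega> = "\<Sum>j\<in>UNIV. l1_norm (omega_seq (Suc k) $ j - omega_seq k $ j)"
    and ?dm = "l1_norm (m_seq (Suc k) - m_seq k)"
  have "F (omega_seq (Suc k)) (m_seq k) + \<gamma> * ?d\<omega> \<le> F (omega_seq k) (m_seq k)"
    unfolding F_def sum_distrib_left sum.distrib[symmetric] seq_Suc(1)
    by (intro sum_mono omega_update_descent)
  moreover have "F (omega_seq (Suc k)) (m_seq (Suc k)) + \<beta> * ?dm \<le> F (omega_seq (Suc k)) (m_seq k)"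
    unfolding seq_Suc(2) by (rule m_update_descent)
  moreover have "norm (iterate \<omega>0 m0 (Suc k) - iterate \<omega>0 m0 k) \<le> ?d\<omega> + ?dm"
    using norm_le_l1_norm[of "iterate \<omega>0 m0 (Suc k) - iterate \<omega>0 m0 k"]
    by (simp add: iterate_eq stack_diff l1_norm_stack)
  then have "min \<gamma> \<beta> * norm (iterate \<omega>0 m0 (Suc k) - iterate \<omega>0 m0 k) \<le> min \<gamma> \<beta> * (?d\<omega> + ?dm)"
    using gamma_pos beta_pos by (intro mult_left_mono) auto
  moreover have "min \<gamma> \<beta> * ?d\<omega> \<le> \<gamma> * ?d\<omega>" "min \<gamma> \<beta> * ?dm \<le> \<beta> * ?dm"
    by (intro mult_right_mono; simp add: l1_norm_nonneg sum_nonneg)+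
  ultimately show ?thesis by (simp add: distrib_left)
qed

lemma convergent_iterate: "convergent (iterate \<omega>0 m0)"
  using gamma_pos beta_pos
  by (intro convergent_if_steps_bounded_by_decrease[where f = "\<lambda>k. F (omega_seq k) (m_seq k)",
        OF _ F_nonneg iterate_descent]) auto

lemma state_gradient_limit_le:
  assumes \<omega>: "omega_seq \<longlonglongrightarrow> \<omega>" and m: "m_seq \<longlonglongrightarrow> m"
    and L: "0 \<le> L" "\<And>\<xi> :: complex ^ 'm. l1_norm \<xi> \<le> L * norm \<xi>"
  shows "norm (state_gradient j (\<omega> $ j) m) \<le> \<gamma> * L"
proof (cases "state_gradient j (\<omega> $ j) m = 0")
  case True
  then show ?thesis using L gamma_pos by simp
next
  case False
  let ?G = "state_gradient j (\<omega> $ j) m"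
  have \<omega>j: "(\<lambda>k. omega_seq k $ j) \<longlonglongrightarrow> \<omega> $ j" using \<omega> by (rule tendsto_vec_nth)
  have "(\<lambda>k. v_seq k $ j) \<longlonglongrightarrow> ?G"
    by (rule direction_tendsto[OF tendsto_state_gradient[OF \<omega>j m] False seq_Suc(3)])
  \<comment> \<open>The slope mixes indices \<open>Suc k\<close> and \<open>k\<close>, but since
    both sequences converge its limit is the slope at the common limit point.\<close>
  then have rhs: "(\<lambda>k. \<gamma> * l1_norm (v_seq k $ j)) \<longlonglongrightarrow> \<gamma> * l1_norm ?G"
    and lhs: "(\<lambda>k. cmod (cdot (state_gradient j (omega_seq (Suc k) $ j) (m_seq k)) (v_seq k $ j)))
      \<longlonglongrightarrow> cmod (cdot ?G ?G)"
    by (intro tendsto_intros tendsto_l1_norm tendsto_cdot tendsto_state_gradient m LIMSEQ_Suc[OF \<omega>j];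
        assumption)+
  have "cmod (cdot ?G ?G) \<le> \<gamma> * l1_norm ?G"
    using omega_update_optimality by (intro LIMSEQ_le[OF lhs rhs]) (simp add: seq_Suc(1))
  also have "\<dots> \<le> \<gamma> * (L * norm ?G)"
    using L gamma_pos by (intro mult_left_mono) auto
  finally have "norm ?G * norm ?G \<le> \<gamma> * L * norm ?G"
    by (simp add: cdot_self norm_mult power2_eq_square mult.assoc)
  then show ?thesis using False by simp
qed

lemma contrast_gradient_limit_le:
  assumes \<omega>: "omega_seq \<longlonglongrightarrow> \<omega>" and m: "m_seq \<longlonglongrightarrow> m"
  shows "cmod (contrast_gradient \<omega> m $ l) \<le> \<beta>"
proof (rule LIMSEQ_le_const2)
  \<comment> \<open>The index is shifted because the bound holds only after a contrast update, not
    for the arbitrary initial contrast.\<close>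
  show "(\<lambda>k. cmod (contrast_gradient (omega_seq (Suc k)) (m_seq (Suc k)) $ l))
      \<longlonglongrightarrow> cmod (contrast_gradient \<omega> m $ l)"
    by (intro tendsto_intros tendsto_contrast_gradient LIMSEQ_Suc \<omega> m)
  show "\<exists>N. \<forall>k\<ge>N. cmod (contrast_gradient (omega_seq (Suc k)) (m_seq (Suc k)) $ l) \<le> \<beta>"
    unfolding seq_Suc(2) using m_update_optimality by blast
qed

lemma stationary_limit:
  assumes "0 \<le> L" "\<And>\<xi> :: complex ^ 'm. l1_norm \<xi> \<le> L * norm \<xi>"
  shows "max_norm (complex_gradient F_stacked (lim (iterate \<omega>0 m0))) \<le> max (\<gamma> * L) \<beta>"
proof -
  let ?z = "lim (iterate \<omega>0 m0)"
  have z: "(\<lambda>k. stack (omega_seq k) (m_seq k)) \<longlonglongrightarrow> ?z"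
    using convergent_iterate by (simp add: convergent_LIMSEQ_iff iterate_eq[abs_def])
  have m: "m_seq \<longlonglongrightarrow> m_part ?z"
    using bounded_linear.tendsto[OF bounded_linear_m_part z] by simp
  have \<omega>: "omega_seq \<longlonglongrightarrow> omega_part ?z"
    using bounded_linear.tendsto[OF bounded_linear_omega_part z] by (simp add: vec_tendstoI)
  show ?thesis
    unfolding complex_gradient_eqI[OF GDERIV_F_stacked]
    using state_gradient_limit_le[OF \<omega> m assms] contrast_gradient_limit_le[OF \<omega> m]
    by (intro max_norm_stack_le) (auto simp: le_max_iff_disj)
qed

end

end

theorem corollary5p5:
  fixes \<kappa> h \<gamma> \<beta> :: real
    and N :: nat
    and p :: "'m::finite \<Rightarrow> int ^ 'n"
    and xhat :: "'q::finite \<Rightarrow> real ^ 'n"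
    and d :: "'j::finite \<Rightarrow> real ^ 'n"
    and ud :: "'j \<Rightarrow> complex ^ 'q"
    and \<eta>\<^sub>s \<eta>\<^sub>d :: "'j \<Rightarrow> real"
    and \<omega>0 :: "complex ^ 'm ^ 'j"
    and m0 :: "complex ^ 'm"
    and z :: "nat \<Rightarrow> complex ^ ('j \<times> 'm + 'm)"
  assumes "CARD('n) = 2 \<or> CARD('n) = 3"
    and "\<kappa> > 0" and "h > 0" and "N > 0"
    and "bij_betw p UNIV (grid N)"
    and "inj xhat" and "\<And>a. norm (xhat a) = 1"
    and "inj d" and "\<And>j. norm (d j) = 1"
    and "\<And>j. \<eta>\<^sub>s j > 0" and "\<And>j. \<eta>\<^sub>d j > 0"
    and "\<gamma> > 0" and "\<beta> > 0"
    and "z = ircsi.iterate \<kappa> h p xhat d ud \<eta>\<^sub>s \<eta>\<^sub>d \<gamma> \<beta> \<omega>0 m0"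
  shows "convergent z \<and>
    (\<forall>L \<epsilon>. sqrt (real CARD('m)) \<le> L \<and> (\<forall>\<xi> :: complex ^ 'm. l1_norm \<xi> \<le> L * norm \<xi>)
            \<and> \<epsilon> = max (\<gamma> * L) \<beta>
       \<longrightarrow> max_norm (complex_gradient (ircsi.F_stacked \<kappa> h p xhat d ud \<eta>\<^sub>s \<eta>\<^sub>d) (lim z)) \<le> \<epsilon>)"
proof -
  interpret ircsi_positive \<kappa> h p xhat d ud \<eta>\<^sub>s \<eta>\<^sub>d \<gamma> \<beta>
    by unfold_locales (rule assms)+
  \<comment> \<open>The lower bound on \<open>L\<close> supplies the nonnegativity assumed in
    \<open>stationary_limit\<close>.\<close>
  have "0 \<le> L" if "sqrt (real CARD('m)) \<le> L" for L
    using that by (rule order_trans[rotated]) simp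
  then show ?thesis
    using convergent_iterate stationary_limit by (auto simp: \<open>z = _\<close>)
qed

end
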